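(* Let $(P_j)_{1\le j\le N}$ be $N$ homogeneous complex polynomials of degree $k\ge 2$ in $N$ variables. If $$\forall z=(z_1,\dots,z_N)\in\mathbb C^N,\qquad \sum_{i=1}^N z_iP_i(z)=0,$$ then the $P_j$ have a non-trivial common root, i.e. there exists $z\in\mathbb C^N\setminus\{0\}$ with $P_1(z)=\cdots=P_N(z)=0$. *)

theory Defs
  imports "HOL-Analysis.Analysis" "HOL-Library.Poly_Mapping"
begin

text \<open>
  A polynomial in the variables indexed by a finite type \<open>'n\<close> is a finitely supported map from
  exponent vectors to coefficients; ring operations are those of \<open>HOL-Library.Poly_Mapping\<close>.
\<close>

type_synonym ('n, 'a) mvpoly = "('n \<Rightarrow>\<^sub>0 nat) \<Rightarrow>\<^sub>0 'a"

definition mvpoly_eval :: "('n::finite, 'a::comm_semiring_1) mvpoly \<Rightarrow> 'a ^ 'n \<Rightarrow> 'a" where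
  "mvpoly_eval p z =
     (\<Sum>m\<in>Poly_Mapping.keys p.
        Poly_Mapping.lookup p m * (\<Prod>i\<in>UNIV. (z $ i) ^ Poly_Mapping.lookup m i))"

text \<open>The zero polynomial counts as homogeneous of every degree.\<close>

definition homogeneous_of_degree :: "nat \<Rightarrow> ('n::finite, 'a::zero) mvpoly \<Rightarrow> bool" where
  "homogeneous_of_degree k p \<longleftrightarrow>
     (\<forall>m\<in>Poly_Mapping.keys p. (\<Sum>i\<in>UNIV. Poly_Mapping.lookup m i) = k)"

end

theory Submission
  imports Defs
begin

text \<open>
  Suppose that \<open>0\<close> is the only common root, and let \<open>v z\<close> be the complex conjugate of
  \<open>(P\<^sub>1 z, \<dots>, P\<^sub>N z)\<close>.  The idea is to compute the degree of \<open>v\<close> on spheres around \<open>0\<close> in two ways.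

  The hypothesis \<open>\<Sum>i. z\<^sub>i P\<^sub>i z = 0\<close> says that \<open>v z\<close> is orthogonal to \<open>z\<close>.  Hence no segment from \<open>z \<noteq> 0\<close>
  to \<open>v z\<close> meets \<open>0\<close>, so \<open>v\<close> is homotopic to the identity away from \<open>0\<close> and has degree \<open>1\<close>.  On the
  other hand let \<open>\<omega> = exp (2 \<pi> \<i> / k)\<close>, which differs from \<open>1\<close> because \<open>k \<ge> 2\<close>.  Homogeneity gives
  \<open>v (\<omega> z) = v z\<close>, so nonzero points with equal value of \<open>v\<close> come at least in pairs.  They all count
  with the same sign, because \<open>v\<close> is antiholomorphic.  So the degree cannot be \<open>1\<close>.

  The degree is handled through integrals.  The integral of a Jacobian determinant over a compact
  set depends only on the values of the map outside the set (\<open>integral_det_eq_of_boundary_eq\<close>);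
  this rests on a polynomial argument: adding a large multiple of the identity makes the maps
  bijective, and the integral is polynomial in the multiplier.  Weighting with a bump function that
  is itself a Jacobian determinant localises the statement, and for a tangential field it becomes
  the equality of \<open>\<integral> \<rho>(v x) det (v' x) dx\<close> over the unit ball with \<open>\<integral> \<rho>\<close> for all such bumps \<open>\<rho>\<close> near \<open>0\<close>
  (\<open>tangential_field_bump_integral\<close>).  If \<open>\<rho>\<close> is concentrated near a regular value of \<open>v\<close>, two
  disjoint neighbourhoods contribute \<open>\<integral> \<rho>\<close> each to the left-hand side, up to a common sign
  (\<open>no_invariant_tangential_field\<close>).  That there is only one sign follows from
  \<open>det_complex_linear_nonneg\<close>.
\<close>

section \<open>Determinants depending polynomially on a parameter\<close>

text \<open>
  The coefficients depend continuously on \<open>x\<close>, so that integrating over \<open>x\<close> leaves a polynomial in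
  the scalar argument.
\<close>

definition polynomial_family :: "'b::topological_space set \<Rightarrow> ('a::real_normed_field \<Rightarrow> 'b \<Rightarrow> 'a) \<Rightarrow> bool" where
  "polynomial_family S h \<longleftrightarrow>
     (\<exists>n c. (\<forall>i. continuous_on S (c i)) \<and> (\<forall>\<mu> x. h \<mu> x = (\<Sum>i\<le>n. c i x * \<mu> ^ i)))"

lemma polynomial_family_const:
  assumes "continuous_on S f"
  shows "polynomial_family S (\<lambda>\<mu> x. f x)"
  unfolding polynomial_family_def
  by (rule exI[of _ 0], rule exI[of _ "\<lambda>i. f"]) (use assms in auto)

lemma polynomial_family_shift:
  assumes "polynomial_family S h"
  shows "polynomial_family S (\<lambda>\<mu> x. \<mu> * h \<mu> x)"
proof -
  obtain n c where c: "\<And>i. continuous_on S (c i)" "\<And>\<mu> x. h \<mu> x = (\<Sum>i\<le>n. c i x * \<mu> ^ i)"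
    using assms unfolding polynomial_family_def by blast
  define d where "d = (\<lambda>i. case i of 0 \<Rightarrow> (\<lambda>x. 0) | Suc j \<Rightarrow> c j)"
  have "continuous_on S (d i)" for i
    by (cases i) (auto simp: d_def c)
  moreover have "\<mu> * h \<mu> x = (\<Sum>i\<le>Suc n. d i x * \<mu> ^ i)" for \<mu> x
    unfolding sum.atMost_Suc_shift by (simp add: d_def c sum_distrib_left mult_ac)
  ultimately show ?thesis
    unfolding polynomial_family_def by blast
qed

lemma polynomial_family_add:
  assumes "polynomial_family S h" "polynomial_family S k"
  shows "polynomial_family S (\<lambda>\<mu> x. h \<mu> x + k \<mu> x)"
proof -
  obtain n c where c: "\<And>i. continuous_on S (c i)" "\<And>\<mu> x. h \<mu> x = (\<Sum>i\<le>n. c i x * \<mu> ^ i)"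
    using assms(1) unfolding polynomial_family_def by blast
  obtain m d where d: "\<And>i. continuous_on S (d i)" "\<And>\<mu> x. k \<mu> x = (\<Sum>i\<le>m. d i x * \<mu> ^ i)"
    using assms(2) unfolding polynomial_family_def by blast
  define e where "e = (\<lambda>i x. (if i \<le> n then c i x else 0) + (if i \<le> m then d i x else 0))"
  have "continuous_on S (e i)" for i
    unfolding e_def by (cases "i \<le> n"; cases "i \<le> m") (auto intro!: continuous_intros c d)
  moreover have "h \<mu> x + k \<mu> x = (\<Sum>i\<le>max n m. e i x * \<mu> ^ i)" for \<mu> x
  proof -
    have "(\<Sum>i\<le>n. c i x * \<mu> ^ i) = (\<Sum>i\<le>max n m. (if i \<le> n then c i x else 0) * \<mu> ^ i)"
      by (rule sum.mono_neutral_cong_left) auto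
    moreover have "(\<Sum>i\<le>m. d i x * \<mu> ^ i) = (\<Sum>i\<le>max n m. (if i \<le> m then d i x else 0) * \<mu> ^ i)"
      by (rule sum.mono_neutral_cong_left) auto
    ultimately show ?thesis
      by (simp add: c d e_def distrib_right sum.distrib)
  qed
  ultimately show ?thesis
    unfolding polynomial_family_def by blast
qed

lemma polynomial_family_sum:
  assumes "\<And>i. i \<in> I \<Longrightarrow> polynomial_family S (h i)"
  shows "polynomial_family S (\<lambda>\<mu> x. \<Sum>i\<in>I. h i \<mu> x)"
  using assms
proof (induction I rule: infinite_finite_induct)
  case (insert i I)
  then show ?case by (simp add: polynomial_family_add)
qed (auto intro: polynomial_family_const)

lemma polynomial_family_scale:
  assumes "continuous_on S f" "polynomial_family S h"
  shows "polynomial_family S (\<lambda>\<mu> x. f x * h \<mu> x)"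
proof -
  obtain n c where c: "\<And>i. continuous_on S (c i)" "\<And>\<mu> x. h \<mu> x = (\<Sum>i\<le>n. c i x * \<mu> ^ i)"
    using assms(2) unfolding polynomial_family_def by blast
  have "continuous_on S (\<lambda>x. f x * c i x)" for i
    by (intro continuous_intros assms c)
  moreover have "f x * h \<mu> x = (\<Sum>i\<le>n. (f x * c i x) * \<mu> ^ i)" for \<mu> x
    by (simp add: c sum_distrib_left mult_ac)
  ultimately show ?thesis
    unfolding polynomial_family_def by (intro exI[of _ n] exI[of _ "\<lambda>i x. f x * c i x"]) auto
qed

lemma polynomial_family_affine_prod:
  assumes "finite I" "\<And>i. i \<in> I \<Longrightarrow> continuous_on S (a i)"
  shows "polynomial_family S (\<lambda>\<mu> x. \<Prod>i\<in>I. (\<mu> * b i + a i x))"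
  using assms
proof (induction I rule: finite_induct)
  case empty
  show ?case by (simp add: polynomial_family_const)
next
  case (insert i I)
  then have IH: "polynomial_family S (\<lambda>\<mu> x. \<Prod>i\<in>I. (\<mu> * b i + a i x))" by auto
  have "polynomial_family S (\<lambda>\<mu> x. \<mu> * (b i * (\<Prod>i\<in>I. (\<mu> * b i + a i x))) + a i x * (\<Prod>i\<in>I. (\<mu> * b i + a i x)))"
    by (intro polynomial_family_add polynomial_family_shift polynomial_family_scale IH continuous_intros insert.prems) auto
  then show ?case
    using insert.hyps by (simp add: algebra_simps)
qed

text \<open>
  Every term of the Leibniz expansion is a product of factors affine in the parameter.  The
  lemma is used over the reals, with \<open>B\<close> the identity, to recover an integral at \<open>\<mu> = 0\<close> from large
  \<open>\<mu>\<close>, and over the complex numbers, to see that a line of matrices containing an invertible one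
  contains only finitely many singular ones.
\<close>

lemma polynomial_family_det:
  fixes A :: "'b::topological_space \<Rightarrow> 'a::real_normed_field ^ 'n ^ 'n"
  assumes "\<And>i j. continuous_on S (\<lambda>x. A x $ i $ j)"
  shows "polynomial_family S (\<lambda>\<mu> x. det (\<chi> i j. \<mu> * B $ i $ j + A x $ i $ j))"
  unfolding det_def vec_lambda_beta
  by (intro polynomial_family_sum polynomial_family_scale polynomial_family_affine_prod assms
      continuous_intros) auto

text \<open>
  The two integrals are polynomials in the parameter that agree on a half-line, hence everywhere.
\<close>

lemma integral_polynomial_family_eq:
  fixes h k :: "real \<Rightarrow> 'b::euclidean_space \<Rightarrow> real"
  assumes h: "polynomial_family S h" and k: "polynomial_family S k" and S: "compact S"
    and eq: "\<And>\<mu>. \<mu> > L \<Longrightarrow> integral S (h \<mu>) = integral S (k \<mu>)"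
  shows "integral S (h \<nu>) = integral S (k \<nu>)"
proof -
  have *: "\<exists>n c. (\<forall>i. continuous_on S (c i)) \<and> (\<forall>\<mu> x. h \<mu> x - k \<mu> x = (\<Sum>i\<le>n. c i x * \<mu> ^ i))"
  proof -
    have "polynomial_family S (\<lambda>\<mu> x. h \<mu> x + (-1) * k \<mu> x)"
      by (intro polynomial_family_add h polynomial_family_scale k continuous_intros)
    then show ?thesis unfolding polynomial_family_def by simp
  qed
  have int: "f integrable_on S" if "continuous_on S f" for f :: "'b \<Rightarrow> real"
    using that S by (metis borel_integrable_compact
        set_borel_integral_eq_integral(1) set_integrable_def)
  have cont: "continuous_on S (g \<mu>)" if "polynomial_family S g" for g :: "real \<Rightarrow> 'b \<Rightarrow> real" and \<mu>
  proof -
    obtain n c where c: "\<And>i. continuous_on S (c i)" "\<And>\<mu> x. g \<mu> x = (\<Sum>i\<le>n. c i x * \<mu> ^ i)"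
      using \<open>polynomial_family S g\<close> unfolding polynomial_family_def by blast
    have "g \<mu> = (\<lambda>x. \<Sum>i\<le>n. c i x * \<mu> ^ i)" using c by auto
    then show ?thesis using c by (auto intro!: continuous_intros)
  qed
  obtain n c where c: "\<And>i. continuous_on S (c i)"
      "\<And>\<mu> x. h \<mu> x - k \<mu> x = (\<Sum>i\<le>n. c i x * \<mu> ^ i)"
    using * by blast
  have diff: "integral S (h \<mu>) - integral S (k \<mu>) = (\<Sum>i\<le>n. integral S (c i) * \<mu> ^ i)" for \<mu>
  proof -
    have "integral S (h \<mu>) - integral S (k \<mu>) = integral S (\<lambda>x. \<Sum>i\<le>n. c i x * \<mu> ^ i)"
      unfolding c(2)[symmetric]
      by (rule integral_diff[symmetric]) (intro int cont h k)+
    also have "\<dots> = (\<Sum>i\<le>n. integral S (\<lambda>x. c i x * \<mu> ^ i))"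
      by (rule integral_sum) (auto intro!: int continuous_intros c)
    finally show ?thesis by simp
  qed
  have "\<not> finite {\<mu>. (\<Sum>i\<le>n. integral S (c i) * \<mu> ^ i) = 0}"
  proof
    assume "finite {\<mu>. (\<Sum>i\<le>n. integral S (c i) * \<mu> ^ i) = 0}"
    moreover have "{L<..} \<subseteq> {\<mu>. (\<Sum>i\<le>n. integral S (c i) * \<mu> ^ i) = 0}"
    proof
      fix \<mu> assume "\<mu> \<in> {L<..}"
      then have "integral S (h \<mu>) - integral S (k \<mu>) = 0"
        using eq[of \<mu>] by simp
      then show "\<mu> \<in> {\<mu>. (\<Sum>i\<le>n. integral S (c i) * \<mu> ^ i) = 0}"
        unfolding diff by simp
    qed
    ultimately show False
      using infinite_Ioi[of L] finite_subset[of "{L<..}"] by blast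
  qed
  then have "\<forall>i\<le>n. integral S (c i) = 0"
    using polyfun_finite_roots[of "\<lambda>i. integral S (c i)" n] by metis
  then show ?thesis
    using diff[of \<nu>] by simp
qed

section \<open>Integrals of Jacobian determinants\<close>

text \<open>
  Continuously differentiable maps between Euclidean spaces.  The Jacobian matrix is part of the
  data, since its determinant is what gets integrated.
\<close>

definition has_jacobian :: "(real^'n \<Rightarrow> real^'m) \<Rightarrow> (real^'n \<Rightarrow> real^'n^'m) \<Rightarrow> bool" where
  "has_jacobian f A \<longleftrightarrow>
     (\<forall>x. (f has_derivative (\<lambda>h. A x *v h)) (at x)) \<and> continuous_on UNIV A"

lemma has_jacobianD:
  assumes "has_jacobian f A"
  shows "(f has_derivative (\<lambda>h. A x *v h)) (at x within S)" "continuous_on S A" "continuous_on S f"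
proof -
  have D: "(f has_derivative (\<lambda>h. A x *v h)) (at x within S)" for x S
    using assms unfolding has_jacobian_def by (simp add: has_derivative_at_withinI)
  show "(f has_derivative (\<lambda>h. A x *v h)) (at x within S)" "continuous_on S f"
    by (rule D, rule has_derivative_continuous_on, rule D)
  show "continuous_on S A"
    using assms unfolding has_jacobian_def by (meson continuous_on_subset subset_UNIV)
qed

lemma continuous_on_det_matrix:
  fixes A :: "'b::topological_space \<Rightarrow> 'a::real_normed_field ^ 'n ^ 'n"
  assumes "continuous_on S A"
  shows "continuous_on S (\<lambda>x. det (A x))"
  unfolding det_def by (intro continuous_intros assms)

lemma has_jacobian_compose:
  assumes f: "has_jacobian f A" and g: "has_jacobian g B"
  shows "has_jacobian (g \<circ> f) (\<lambda>x. B (f x) ** A x)"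
  unfolding has_jacobian_def
proof (intro conjI allI)
  fix x
  have "((g \<circ> f) has_derivative ((\<lambda>h. B (f x) *v h) \<circ> (\<lambda>h. A x *v h))) (at x)"
    by (intro diff_chain_within has_jacobianD[OF f] has_jacobianD(1)[OF g])
  then show "((g \<circ> f) has_derivative (\<lambda>h. (B (f x) ** A x) *v h)) (at x)"
    by (simp add: o_def matrix_vector_mul_assoc)
next
  have B: "continuous_on UNIV (\<lambda>x. B (f x))"
    using continuous_on_compose[OF has_jacobianD(3)[OF f] has_jacobianD(2)[OF g]]
    by (simp add: o_def)
  show "continuous_on UNIV (\<lambda>x. B (f x) ** A x)"
    unfolding matrix_matrix_mult_def
    by (intro continuous_intros B has_jacobianD(2)[OF f])
qed

lemma det_nonzero_iff_kernel_trivial: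
  fixes M :: "'a::field^'n^'n"
  shows "det M \<noteq> 0 \<longleftrightarrow> (\<forall>h. M *v h = 0 \<longrightarrow> h = 0)"
  by (metis invertible_det_nz invertible_left_inverse matrix_left_invertible_ker)

lemma integrable_continuous_compact:
  fixes f :: "'b::euclidean_space \<Rightarrow> real"
  assumes "continuous_on S f" "compact S"
  shows "f integrable_on S"
  using assms by (metis borel_integrable_compact set_borel_integral_eq_integral(1) set_integrable_def)

text \<open>
  The segment from \<open>\<mu> \<cdot> 1\<close> to \<open>\<mu> \<cdot> 1 + A\<close> contains no singular matrix, because \<open>\<mu>\<close> exceeds the
  operator norm of \<open>A\<close>; so the determinant keeps the sign it has at the starting point.
\<close>

lemma det_pos_of_dominant:
  fixes A :: "real^'n^'n"
  assumes bd: "\<And>h. norm (A *v h) \<le> L * norm h" and L: "0 \<le> L" "L < \<mu>"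
  shows "det (\<chi> i j. \<mu> * mat 1 $ i $ j + A $ i $ j) > 0"
proof -
  define M where "M = (\<lambda>s::real. (\<chi> i j. \<mu> * mat 1 $ i $ j + s * A $ i $ j) :: real^'n^'n)"
  have MV: "M s *v h = \<mu> *\<^sub>R h + s *\<^sub>R (A *v h)" for s h
  proof -
    have "M s = \<mu> *\<^sub>R mat 1 + s *\<^sub>R A" by (simp add: M_def vec_eq_iff)
    then show ?thesis
      by (simp add: matrix_vector_mult_add_rdistrib scaleR_matrix_vector_assoc[symmetric])
  qed
  have nz: "det (M s) \<noteq> 0" if s: "0 \<le> s" "s \<le> 1" for s
  proof -
    have "h = 0" if "M s *v h = 0" for h
    proof -
      have "\<mu> * norm h = norm (\<mu> *\<^sub>R h)" using L by simp
      also have "\<dots> = norm (s *\<^sub>R (A *v h))"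
        using that by (metis MV add_eq_0_iff2 norm_minus_cancel)
      also have "\<dots> = s * norm (A *v h)" using s by simp
      also have "\<dots> \<le> 1 * (L * norm h)"
        by (intro mult_mono bd s) auto
      finally have "(\<mu> - L) * norm h \<le> 0" by (simp add: algebra_simps)
      then show "h = 0" using L by (simp add: mult_le_0_iff)
    qed
    then show ?thesis
      by (simp add: det_nonzero_iff_kernel_trivial)
  qed
  have cont: "continuous_on {0..1} (\<lambda>s. det (M s))"
    unfolding M_def by (intro continuous_on_det_matrix continuous_intros)
  have M0: "det (M 0) = \<mu> ^ CARD('n)"
  proof -
    have "M 0 = (\<chi> i j. if i = j then \<mu> else 0)" by (simp add: M_def mat_def vec_eq_iff)
    then have "det (M 0) = (\<Prod>i\<in>UNIV. M 0 $ i $ i)"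
      by (intro det_diagonal) simp
    then show ?thesis by (simp add: M_def mat_def)
  qed
  have "det (M 1) > 0"
  proof (rule ccontr)
    assume "\<not> det (M 1) > 0"
    then have "\<exists>s\<ge>0. s \<le> 1 \<and> det (M s) = 0"
      using M0 L cont by (intro IVT2') auto
    then show False using nz by blast
  qed
  then show ?thesis by (simp add: M_def)
qed

text \<open>
  Solving \<open>\<mu> x + F x = y\<close> means finding a fixed point of the contraction \<open>x \<mapsto> (y - F x) / \<mu>\<close>.
\<close>

lemma lipschitz_perturbation_bij:
  fixes F :: "'a::{real_normed_vector,complete_space} \<Rightarrow> 'a"
  assumes lip: "\<And>x y. norm (F x - F y) \<le> L * norm (x - y)" and L: "0 \<le> L" "L < \<mu>"
  shows "bij (\<lambda>x. \<mu> *\<^sub>R x + F x)"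
proof (rule bijI)
  show "inj (\<lambda>x. \<mu> *\<^sub>R x + F x)"
  proof (rule injI)
    fix x y assume "\<mu> *\<^sub>R x + F x = \<mu> *\<^sub>R y + F y"
    then have "\<mu> *\<^sub>R (x - y) = - (F x - F y)" by (simp add: algebra_simps)
    then have "norm (\<mu> *\<^sub>R (x - y)) = norm (F x - F y)" by (metis norm_minus_cancel)
    then have "\<mu> * norm (x - y) \<le> L * norm (x - y)" using lip[of x y] L by simp
    then have "(\<mu> - L) * norm (x - y) \<le> 0" by (simp add: algebra_simps)
    then show "x = y" using L by (simp add: mult_le_0_iff)
  qed
  show "surj (\<lambda>x. \<mu> *\<^sub>R x + F x)"
    unfolding surj_def
  proof
    fix y
    have "\<exists>!x. (1/\<mu>) *\<^sub>R (y - F x) = x"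
    proof (rule banach_fix_type[of "L / \<mu>"])
      show "0 \<le> L / \<mu>" "L / \<mu> < 1" using L by auto
      show "\<forall>x z. dist ((1/\<mu>) *\<^sub>R (y - F x)) ((1/\<mu>) *\<^sub>R (y - F z)) \<le> L / \<mu> * dist x z"
      proof (intro allI)
        fix x z
        have "dist ((1/\<mu>) *\<^sub>R (y - F x)) ((1/\<mu>) *\<^sub>R (y - F z)) = (1/\<mu>) * norm (F z - F x)"
          unfolding dist_norm scaleR_diff_right[symmetric] using L by simp
        also have "\<dots> \<le> (1/\<mu>) * (L * norm (z - x))"
          using L by (intro mult_left_mono lip) auto
        finally show "dist ((1/\<mu>) *\<^sub>R (y - F x)) ((1/\<mu>) *\<^sub>R (y - F z)) \<le> L / \<mu> * dist x z"
          by (simp add: dist_norm norm_minus_commute)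
      qed
    qed
    then obtain x where x: "(1/\<mu>) *\<^sub>R (y - F x) = x" by blast
    have "\<mu> *\<^sub>R x = y - F x"
      using L by (subst x[symmetric]) simp
    then show "\<exists>x. y = \<mu> *\<^sub>R x + F x" by (metis diff_add_cancel)
  qed
qed

text \<open>
  This is the invariance of the degree, in a form that needs neither Stokes' theorem nor
  homotopies.  For large \<open>\<mu>\<close> both \<open>\<mu> x + F x\<close> and \<open>\<mu> x + G x\<close> are bijections of the whole space
  with positive Jacobian determinant.  They agree off \<open>S\<close>, so they have the same image of \<open>S\<close>, whose
  measure is the integral of either determinant.  These integrals are polynomials in \<open>\<mu>\<close>, so they
  also agree at \<open>\<mu> = 0\<close>, where nothing is known to be injective.
\<close>

lemma integral_det_eq_of_boundary_eq:
  fixes F G :: "real^'m::{finite,wellorder} \<Rightarrow> real^'m::_"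
  assumes F: "has_jacobian F A" and G: "has_jacobian G B" and S: "compact S"
    and eq: "\<And>x. x \<notin> S \<Longrightarrow> F x = G x"
    and bd: "\<And>x h. norm (B x *v h) \<le> L * norm h"
  shows "integral S (\<lambda>x. det (A x)) = integral S (\<lambda>x. det (B x))"
proof -
  have AB: "A x = B x" if "x \<notin> S" for x
  proof -
    have "(F has_derivative (\<lambda>h. B x *v h)) (at x)"
      by (rule has_derivative_transform_within_open[OF has_jacobianD(1)[OF G], of "-S"])
        (use S compact_imp_closed eq that in auto)
    then have "(\<lambda>h. A x *v h) = (\<lambda>h. B x *v h)"
      by (rule has_derivative_unique[OF has_jacobianD(1)[OF F]])
    then show ?thesis by (metis matrix_of_matrix_vector_mul)
  qed
  have "bounded (A ` S)"
    by (intro compact_imp_bounded compact_continuous_image has_jacobianD(2)[OF F] S)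
  then obtain K where K: "\<And>x. x \<in> S \<Longrightarrow> norm (A x) \<le> K"
    by (auto simp: bounded_iff)
  (* One constant dominating both Jacobians on the whole space: off S they coincide, and on the
  compact set S the entries of A are bounded. *)
  define L' where "L' = max \<bar>L\<bar> (real CARD('m) * real CARD('m) * \<bar>K\<bar>)"
  have L'0: "0 \<le> L'" by (simp add: L'_def)
  have bdB: "norm (B x *v h) \<le> L' * norm h" for x h
    using bd[of x h] by (rule order_trans) (auto simp: L'_def intro!: mult_right_mono)
  have bdA: "norm (A x *v h) \<le> L' * norm h" for x h
  proof (cases "x \<in> S")
    case True
    have "\<bar>A x $ i $ j\<bar> \<le> \<bar>K\<bar>" for i j
    proof -
      have "\<bar>A x $ i $ j\<bar> \<le> norm (A x $ i)" by (rule component_le_norm_cart)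
      also have "\<dots> \<le> norm (A x)" by (rule Finite_Cartesian_Product.norm_nth_le)
      also have "\<dots> \<le> \<bar>K\<bar>" using K[OF True] by linarith
      finally show ?thesis .
    qed
    then have "onorm ((*v) (A x)) \<le> real CARD('m) * real CARD('m) * \<bar>K\<bar>"
      by (rule onorm_le_matrix_component)
    then have "onorm ((*v) (A x)) \<le> L'" by (simp add: L'_def)
    moreover have "norm (A x *v h) \<le> onorm ((*v) (A x)) * norm h"
      by (rule onorm) simp
    ultimately show ?thesis
      by (meson mult_right_mono norm_ge_zero order_trans)
  next
    case False
    then show ?thesis using AB bdB by simp
  qed
  have lip: "norm (H x - H y) \<le> L' * norm (x - y)"
    if H: "has_jacobian H C" and C: "\<And>x h. norm (C x *v h) \<le> L' * norm h" for H C x y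
    by (rule differentiable_bound[OF convex_UNIV, of H "\<lambda>x h. C x *v h"])
      (auto intro: onorm_le C has_jacobianD(1)[OF H])
  define J where "J = (\<lambda>(C :: (real,'m) vec \<Rightarrow> ((real,'m) vec,'m) vec) (\<mu>::real) x. det (\<chi> i j. \<mu> * mat 1 $ i $ j + C x $ i $ j :: ((real,'m) vec,'m) vec))"
  have img: "integral S (J C \<mu>) = measure lebesgue ((\<lambda>x. \<mu> *\<^sub>R x + H x) ` S)"
    if H: "has_jacobian H C" and C: "\<And>x h. norm (C x *v h) \<le> L' * norm h" and \<mu>: "\<mu> > L'" for H :: "(real,'m) vec \<Rightarrow> (real,'m) vec" and C \<mu>
  proof -
    define D where "D = (\<lambda>x. (\<chi> i j. \<mu> * mat 1 $ i $ j + C x $ i $ j) :: ((real,'m) vec,'m) vec)"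
    have DV: "D x *v h = \<mu> *\<^sub>R h + C x *v h" for x h
    proof -
      have "D x = \<mu> *\<^sub>R mat 1 + C x" by (simp add: D_def vec_eq_iff)
      then show ?thesis
        by (simp add: matrix_vector_mult_add_rdistrib scaleR_matrix_vector_assoc[symmetric])
    qed
    have pos: "\<bar>det (matrix (\<lambda>h. D x *v h))\<bar> = J C \<mu> x" for x
      using det_pos_of_dominant[OF C L'0 \<mu>, of x] by (simp add: D_def J_def)
    have "measure lebesgue ((\<lambda>x. \<mu> *\<^sub>R x + H x) ` S)
        = integral S (\<lambda>x. \<bar>det (matrix (\<lambda>h. D x *v h))\<bar>)"
    proof (rule measure_differentiable_image_eq)
      show "S \<in> sets lebesgue" using S by (simp add: lmeasurable_compact fmeasurableD)
      show "((\<lambda>x. \<mu> *\<^sub>R x + H x) has_derivative (\<lambda>h. D x *v h)) (at x within S)" for x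
        unfolding DV by (intro derivative_intros has_jacobianD(1)[OF H])
      show "inj_on (\<lambda>x. \<mu> *\<^sub>R x + H x) S"
        using lipschitz_perturbation_bij[OF lip[OF H C] L'0 \<mu>]
        by (meson bij_is_inj inj_on_subset subset_UNIV)
      show "(\<lambda>x. \<bar>det (matrix (\<lambda>h. D x *v h))\<bar>) integrable_on S"
        unfolding pos J_def
        by (intro integrable_continuous_compact S continuous_on_det_matrix continuous_intros
            has_jacobianD(2)[OF H])
    qed
    then show ?thesis unfolding pos by simp
  qed
  have same: "integral S (J A \<mu>) = integral S (J B \<mu>)" if \<mu>: "\<mu> > L'" for \<mu>
  proof -
    let ?f = "\<lambda>x. \<mu> *\<^sub>R x + F x" and ?g = "\<lambda>x. \<mu> *\<^sub>R x + G x"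
    have "?f ` S = - (?f ` (- S))" "?g ` S = - (?g ` (- S))"
      using lipschitz_perturbation_bij[OF lip[OF F bdA] L'0 \<mu>]
        lipschitz_perturbation_bij[OF lip[OF G bdB] L'0 \<mu>]
      by (simp_all add: bij_image_Compl_eq)
    moreover have "?f ` (- S) = ?g ` (- S)"
      by (rule image_cong) (auto simp: eq)
    ultimately have "?f ` S = ?g ` S" by simp
    then show ?thesis
      by (simp add: img[OF F bdA \<mu>] img[OF G bdB \<mu>])
  qed
  have fam: "polynomial_family S (J C)" if "has_jacobian H C" for H :: "(real,'m) vec \<Rightarrow> (real,'m) vec" and C
    unfolding J_def
    by (intro polynomial_family_det continuous_intros has_jacobianD(2)[OF that])
  have "integral S (J A 0) = integral S (J B 0)"
    by (rule integral_polynomial_family_eq[OF fam[OF F] fam[OF G] S same])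
  then show ?thesis by (simp add: J_def)
qed

section \<open>Localisation by bump functions\<close>

text \<open>
  A \<open>C\<^sup>1\<close> function that is constant outside \<open>[-1, 1]\<close>; its derivative is the truncated parabola
  \<open>hat\<close>.  It serves both for building bumps and as a cut-off.
\<close>

definition smooth_step :: "real \<Rightarrow> real" where
  "smooth_step t = (let c = max (-1) (min 1 t) in c - c ^ 3 / 3)"

definition hat :: "real \<Rightarrow> real" where
  "hat t = 1 - (max (-1) (min 1 t))\<^sup>2"

lemma hat_nonneg: "0 \<le> hat t" and hat_le_1: "hat t \<le> 1"
  and hat_eq_0_iff: "hat t = 0 \<longleftrightarrow> \<bar>t\<bar> \<ge> 1"
proof -
  define c where "c = max (-1) (min 1 t)"
  have c: "\<bar>c\<bar> \<le> 1" by (auto simp: c_def)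
  then have "c\<^sup>2 \<le> 1" by (simp add: abs_square_le_1)
  then show "0 \<le> hat t" "hat t \<le> 1" by (auto simp: hat_def c_def)
  have "c\<^sup>2 = 1 \<longleftrightarrow> \<bar>t\<bar> \<ge> 1"
    unfolding power2_eq_1_iff by (auto simp: c_def max_def min_def)
  then show "hat t = 0 \<longleftrightarrow> \<bar>t\<bar> \<ge> 1" by (auto simp: hat_def c_def)
qed

lemma continuous_on_hat [continuous_intros]:
  "continuous_on S f \<Longrightarrow> continuous_on S (\<lambda>x. hat (f x))"
  unfolding hat_def by (intro continuous_intros)

text \<open>
  At the break points \<open>-1\<close> and \<open>1\<close> the polynomial piece has derivative \<open>0\<close>, as the constant pieces do.
\<close>

lemma smooth_step_has_derivative: "(smooth_step has_real_derivative hat t) (at t)"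
proof -
  have mid: "((\<lambda>t. t - t ^ 3 / 3) has_real_derivative 1 - t\<^sup>2) (at t within S)" for t S
    by (auto intro!: derivative_eq_intros simp: power2_eq_square)
  have eq: "smooth_step = (\<lambda>t. if t \<in> {..-1} then - 2 / 3 else (if t \<in> {-1..1} then t - t ^ 3 / 3 else 2/3))"
    by (auto simp: smooth_step_def fun_eq_iff max_def min_def Let_def)
  have eqh: "hat t = (if t \<in> {-1..1} then 1 - t\<^sup>2 else 0)" for t
    by (auto simp: hat_def max_def min_def)
  consider "t < -1" | "t = -1" | "-1 < t \<and> t < 1" | "t = 1" | "t > 1" by linarith
  then show ?thesis
  proof cases
    case 1
    have "((\<lambda>_. - 2 / 3) has_real_derivative hat t) (at t)" using 1 by (simp add: eqh)
    then show ?thesis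
      by (rule has_field_derivative_transform_within_open[where S = "{..<-1}"]) (use 1 in \<open>auto simp: eq\<close>)
  next
    case 5
    have "((\<lambda>_. 2 / 3) has_real_derivative hat t) (at t)" using 5 by (simp add: eqh)
    then show ?thesis
      by (rule has_field_derivative_transform_within_open[where S = "{1<..}"]) (use 5 in \<open>auto simp: eq\<close>)
  next
    case 3
    have "((\<lambda>t. t - t ^ 3 / 3) has_real_derivative hat t) (at t)" using 3 mid[of t UNIV] by (simp add: eqh)
    then show ?thesis
      by (rule has_field_derivative_transform_within_open[where S = "{-1<..<1}"]) (use 3 in \<open>auto simp: eq\<close>)
  next
    case 2
    have "(smooth_step has_real_derivative 0) (at t within {..t})"
      by (rule has_field_derivative_transform_within[of "\<lambda>_. - 2/3" _ _ _ 1]) (auto simp: eq 2)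
    moreover have "(smooth_step has_real_derivative 0) (at t within {t..})"
      by (rule has_field_derivative_transform_within[of "\<lambda>t. t - t ^ 3 / 3" _ _ _ 1])
        (use mid[of t "{t..}"] in \<open>auto simp: eq 2 dist_real_def\<close>)
    ultimately show ?thesis
      unfolding has_field_derivative_iff by (intro Lim_Un_univ[of _ _ _ "{..t}" "{t..}"]) (auto simp: eqh 2)
  next
    case 4
    have "(smooth_step has_real_derivative 0) (at t within {t..})"
      by (rule has_field_derivative_transform_within[of "\<lambda>_. 2/3" _ _ _ 1]) (auto simp: eq 4)
    moreover have "(smooth_step has_real_derivative 0) (at t within {..t})"
      by (rule has_field_derivative_transform_within[of "\<lambda>t. t - t ^ 3 / 3" _ _ _ 1])
        (use mid[of t "{..t}"] in \<open>auto simp: eq 4 dist_real_def\<close>)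
    ultimately show ?thesis
      unfolding has_field_derivative_iff by (intro Lim_Un_univ[of _ _ _ "{..t}" "{t..}"]) (auto simp: eqh 4)
  qed
qed

text \<open>
  This product is chosen because it is a Jacobian determinant: that of the map applying a rescaled
  \<open>smooth_step\<close> to each coordinate.  Its support is a cube around \<open>w\<close>, of half-width \<open>e\<close>.
\<close>

definition bump :: "real \<Rightarrow> real^'m \<Rightarrow> real^'m \<Rightarrow> real" where
  "bump e w y = (\<Prod>i\<in>UNIV. hat ((y $ i - w $ i) / e) / e)"

lemma bump_nonneg: "e > 0 \<Longrightarrow> 0 \<le> bump e w y"
  unfolding bump_def by (intro prod_nonneg) (simp add: hat_nonneg)

lemma bump_pos_iff:
  assumes "e > 0"
  shows "bump e w y \<noteq> 0 \<longleftrightarrow> (\<forall>i. \<bar>y $ i - w $ i\<bar> < e)"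
proof -
  have "hat ((y $ i - w $ i) / e) / e \<noteq> 0 \<longleftrightarrow> \<bar>y $ i - w $ i\<bar> < e" for i
    using assms by (simp add: hat_eq_0_iff) (auto simp: not_le abs_divide)
  then show ?thesis unfolding bump_def prod_zero_iff[OF finite_class.finite_UNIV] by blast
qed

lemma continuous_on_bump [continuous_intros]:
  "continuous_on S f \<Longrightarrow> e > 0 \<Longrightarrow> continuous_on S (\<lambda>x. bump e w (f x))"
  unfolding bump_def by (auto intro!: continuous_intros)

text \<open>
  Let \<open>\<psi>\<close> be the coordinatewise step map, whose Jacobian determinant is the bump.  Then the two
  integrands are the Jacobian determinants of \<open>\<psi> \<circ> \<Phi>\<close> and \<open>\<psi>\<close>, which agree off \<open>S\<close>.
\<close>

lemma integral_bump_compose_eq: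
  fixes \<Phi> :: "real^'m::{finite,wellorder} \<Rightarrow> real^'m::_"
  assumes \<Phi>: "has_jacobian \<Phi> A" and S: "compact S" and id: "\<And>x. x \<notin> S \<Longrightarrow> \<Phi> x = x"
    and e: "e > 0"
  shows "integral S (\<lambda>x. bump e w (\<Phi> x) * det (A x)) = integral S (bump e w)"
proof -
  define \<psi> where "\<psi> = (\<lambda>y :: (real,'m) vec. \<chi> i. smooth_step ((y $ i - w $ i) / e))"
  define B where "B = (\<lambda>y. (\<chi> i j. if i = j then hat ((y $ i - w $ i) / e) / e else 0)
                          :: ((real,'m) vec,'m) vec)"
  have BV: "B y *v h = (\<chi> i. hat ((y $ i - w $ i) / e) / e * h $ i)" for y h
    by (simp add: B_def matrix_vector_mult_def vec_eq_iff if_distrib[of "\<lambda>x. x * _"] cong: if_cong)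
  have detB: "det (B y) = bump e w y" for y
    unfolding bump_def by (subst det_diagonal) (auto simp: B_def)
  have J: "has_jacobian \<psi> B"
    unfolding has_jacobian_def
  proof (intro conjI allI)
    fix y
    have "((\<lambda>y. smooth_step ((y $ i - w $ i) / e)) has_derivative (\<lambda>h. hat ((y $ i - w $ i) / e) / e * h $ i)) (at y)" for i
    proof -
      have "((\<lambda>y. smooth_step ((y $ i - w $ i) / e)) has_derivative (\<lambda>h. (h $ i / e) * hat ((y $ i - w $ i) / e))) (at y)"
        by (rule DERIV_compose_FDERIV[OF smooth_step_has_derivative])
          (use e in \<open>auto intro!: derivative_eq_intros bounded_linear.has_derivative[OF bounded_linear_vec_nth]\<close>)
      then show ?thesis by (simp add: mult_ac)
    qed
    then show "(\<psi> has_derivative (\<lambda>h. B y *v h)) (at y)"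
      unfolding BV \<psi>_def has_derivative_componentwise_within[where f = "\<lambda>y. vec_lambda (f y)" for f]
      by (auto simp: Basis_vec_def inner_axis)
    show "continuous_on UNIV B"
    proof -
      have "continuous_on UNIV (\<lambda>x. if i = j then hat ((x $ i - w $ i) / e) / e else 0)" for i j :: 'm
        using e by (cases "i = j") (auto intro!: continuous_intros)
      then show ?thesis unfolding B_def by (intro continuous_on_vec_lambda)
    qed
  qed
  have bd: "norm (B y *v h) \<le> (1/e) * norm h" for y h
  proof -
    have "norm (B y *v h) \<le> norm ((1/e) *\<^sub>R h)"
    proof (rule norm_le_componentwise_cart)
      fix i
      have "hat ((y $ i - w $ i) / e) * \<bar>h $ i\<bar> \<le> 1 * \<bar>h $ i\<bar>"
        by (intro mult_right_mono hat_le_1) auto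
      then show "norm ((B y *v h) $ i) \<le> norm (((1/e) *\<^sub>R h) $ i)"
        using e hat_nonneg by (simp add: BV abs_mult divide_simps)
    qed
    then show ?thesis using e by simp
  qed
  have "integral S (\<lambda>x. det (B (\<Phi> x) ** A x)) = integral S (\<lambda>x. det (B x))"
    by (rule integral_det_eq_of_boundary_eq[OF has_jacobian_compose[OF \<Phi> J] J S _ bd])
      (simp add: id)
  then show ?thesis by (simp add: det_mul detB)
qed

section \<open>Tangential fields have degree one\<close>

lemma integral_eq_of_zero_outside:
  fixes f :: "'a::euclidean_space \<Rightarrow> real"
  assumes "S \<subseteq> T" "\<And>x. x \<in> T \<Longrightarrow> x \<notin> S \<Longrightarrow> f x = 0"
  shows "integral S f = integral T f"
proof -
  have "(\<lambda>x. if x \<in> S then f x else 0) = (\<lambda>x. if x \<in> T then f x else 0)"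
    using assms by (auto simp: fun_eq_iff)
  then show ?thesis by (metis integral_restrict_UNIV)
qed

text \<open>
  A field tangent to the spheres around \<open>0\<close> has degree one on them: no segment from \<open>z \<noteq> 0\<close> to
  \<open>v z \<noteq> 0\<close> passes through \<open>0\<close>, the two vectors being orthogonal.  Accordingly let \<open>\<Phi>\<close> equal \<open>v\<close> on the
  unit ball and move along these segments to the identity outside the ball of radius \<open>2\<close>.  It stays
  at distance at least \<open>c\<close> from \<open>0\<close> outside the unit ball, so a bump supported in the ball of
  radius \<open>c\<close> only sees the part of \<open>\<Phi>\<close> that equals \<open>v\<close>.
\<close>

lemma tangential_field_bump_integral:
  fixes v :: "real^'m::{finite,wellorder} \<Rightarrow> real^'m::_"
  assumes v: "has_jacobian v V" and tangential: "\<And>z. v z \<bullet> z = 0"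
    and nz: "\<And>z. norm z \<ge> 1 \<Longrightarrow> v z \<noteq> 0"
  obtains c where "c > 0" "c \<le> 1" "\<And>z. norm z = 1 \<Longrightarrow> c \<le> norm (v z)"
    "\<And>e w. e > 0 \<Longrightarrow> (\<And>y. bump e w y \<noteq> 0 \<Longrightarrow> norm y < c) \<Longrightarrow>
       integral (cball 0 1) (\<lambda>x. bump e w (v x) * det (V x)) = integral (cball 0 2) (bump e w)"
proof -
  (* The cut-off is a function of the squared norm, decreasing from 1 to 0 on [1, 2]. *)
  define \<theta> where "\<theta> = (\<lambda>s. 1/2 - (3/4) * smooth_step (2 * s - 3))"
  define \<theta>' where "\<theta>' = (\<lambda>s. - (3/2) * hat (2 * s - 3))"
  have \<theta>1: "\<theta> s = 1" if "s \<le> 1" for s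
    using that by (simp add: \<theta>_def smooth_step_def min_def max_def)
  have \<theta>2: "\<theta> s = 0" if "s \<ge> 2" for s
    using that by (simp add: \<theta>_def smooth_step_def min_def max_def)
  have \<theta>'1: "\<theta>' s = 0" if "s \<le> 1" for s
    using that by (simp add: \<theta>'_def hat_eq_0_iff)
  have d\<theta>: "(\<theta> has_real_derivative \<theta>' s) (at s)" for s
    unfolding \<theta>_def \<theta>'_def
    by (auto intro!: derivative_eq_intros DERIV_chain'[OF _ smooth_step_has_derivative])
  have c\<theta>: "continuous_on UNIV (\<lambda>z :: (real,'m) vec. \<theta> (z \<bullet> z))"
    by (rule continuous_on_compose2[of UNIV \<theta>])
      (auto intro!: continuous_intros DERIV_continuous_on[of UNIV] d\<theta>)
  have c\<theta>': "continuous_on UNIV (\<lambda>z :: (real,'m) vec. \<theta>' (z \<bullet> z))"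
    unfolding \<theta>'_def by (intro continuous_intros)
  define \<Phi> where "\<Phi> = (\<lambda>z. z + \<theta> (z \<bullet> z) *\<^sub>R (v z - z))"
  (* The rank one matrix that differentiating the cut-off contributes to the Jacobian A. *)
  define Q where "Q = (\<lambda>z. (\<chi> i j. (v z - z) $ i * z $ j) :: ((real,'m) vec,'m) vec)"
  define A where "A = (\<lambda>z. mat 1 + \<theta> (z \<bullet> z) *\<^sub>R (V z - mat 1) + (2 * \<theta>' (z \<bullet> z)) *\<^sub>R Q z)"
  have QV: "Q z *v h = (z \<bullet> h) *\<^sub>R (v z - z)" for z h
    by (simp add: Q_def matrix_vector_mult_def vec_eq_iff inner_vec_def sum_distrib_left
        sum_distrib_right mult_ac)
  have AV: "A z *v h = h + (\<theta> (z \<bullet> z) *\<^sub>R (V z *v h - h) + (\<theta>' (z \<bullet> z) * (2 * (z \<bullet> h))) *\<^sub>R (v z - z))" for z h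
    by (simp add: A_def matrix_vector_mult_add_rdistrib matrix_vector_mult_diff_rdistrib
        scaleR_matrix_vector_assoc[symmetric] QV mult_ac)
  have J: "has_jacobian \<Phi> A"
    unfolding has_jacobian_def
  proof (intro conjI allI)
    fix z :: "(real,'m) vec"
    have "((\<lambda>z. \<theta> (z \<bullet> z)) has_derivative (\<lambda>h. (z \<bullet> h + h \<bullet> z) * \<theta>' (z \<bullet> z))) (at z)"
      by (rule DERIV_compose_FDERIV[OF d\<theta>]) (auto intro!: derivative_eq_intros)
    then have "((\<lambda>z. \<theta> (z \<bullet> z)) has_derivative (\<lambda>h. \<theta>' (z \<bullet> z) * (2 * (z \<bullet> h)))) (at z)"
      by (rule has_derivative_eq_rhs) (simp add: inner_commute algebra_simps fun_eq_iff)
    from has_derivative_add[OF has_derivative_ident has_derivative_scaleR[OF this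
          has_derivative_diff[OF has_jacobianD(1)[OF v] has_derivative_ident]]]
    show "(\<Phi> has_derivative (\<lambda>h. A z *v h)) (at z)"
      unfolding AV \<Phi>_def .
    show "continuous_on UNIV A"
      unfolding A_def Q_def
      by (intro continuous_intros c\<theta> c\<theta>' has_jacobianD(2,3)[OF v])
  qed
  have \<Phi>_inner: "\<Phi> z \<bullet> z = (1 - \<theta> (z \<bullet> z)) * (z \<bullet> z)" for z
    by (simp add: \<Phi>_def inner_add_left inner_diff_left tangential algebra_simps)
  have \<Phi>nz: "\<Phi> z \<noteq> 0" if "norm z \<ge> 1" for z
  proof
    assume 0: "\<Phi> z = 0"
    have "z \<noteq> 0" using that by auto
    then have "\<theta> (z \<bullet> z) = 1" using \<Phi>_inner[of z] 0 by simp
    then have "\<Phi> z = v z" by (simp add: \<Phi>_def)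
    with nz[OF that] 0 show False by simp
  qed
  have in1: "\<Phi> z = v z" if "norm z \<le> 1" for z
  proof -
    have "z \<bullet> z \<le> 1" using that by (simp add: dot_square_norm abs_square_le_1)
    then show ?thesis by (simp add: \<Phi>_def \<theta>1)
  qed
  have A1: "A z = V z" if "norm z \<le> 1" for z
  proof -
    have "z \<bullet> z \<le> 1" using that by (simp add: dot_square_norm abs_square_le_1)
    then show ?thesis by (simp add: A_def \<theta>1 \<theta>'1)
  qed
  have out2: "\<Phi> z = z" if "norm z \<ge> 2" for z
  proof -
    have "2 * 2 \<le> norm z * norm z" using that by (intro mult_mono) auto
    then have "2 \<le> z \<bullet> z" by (simp add: dot_square_norm power2_eq_square)
    then show ?thesis by (simp add: \<Phi>_def \<theta>2)
  qed
  (* Only a compact shell matters for the distance from 0: beyond it \<Phi> is the identity. *)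
  define K where "K = cball (0 :: (real,'m) vec) 2 - ball 0 1"
  have "compact K" unfolding K_def by (intro compact_diff) auto
  then have "compact (\<Phi> ` K)" by (intro compact_continuous_image has_jacobianD(3)[OF J])
  moreover have "0 \<notin> \<Phi> ` K"
    using \<Phi>nz by (auto simp: K_def)
  ultimately obtain c where c: "c > 0" "\<And>y. y \<in> \<Phi> ` K \<Longrightarrow> c \<le> dist 0 y"
    using separate_point_closed compact_imp_closed by metis
  have c': "min c 1 \<le> norm (\<Phi> z)" if "norm z \<ge> 1" for z
  proof (cases "norm z \<le> 2")
    case True
    then have "z \<in> K" using that by (simp add: K_def)
    then show ?thesis using c(2)[of "\<Phi> z"] by simp
  next
    case False
    then show ?thesis using that by (simp add: out2)
  qed
  show thesis
  proof (rule that[of "min c 1"])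
    show "min c 1 > 0" "min c 1 \<le> 1" using c by auto
    show "min c 1 \<le> norm (v z)" if "norm z = 1" for z
      using c'[of z] in1[of z] that by simp
    fix e :: real and w :: "(real,'m) vec" assume e: "e > 0" and supp: "\<And>y. bump e w y \<noteq> 0 \<Longrightarrow> norm y < min c 1"
    have "integral (cball 0 1) (\<lambda>x. bump e w (v x) * det (V x))
        = integral (cball 0 1) (\<lambda>x. bump e w (\<Phi> x) * det (A x))"
      by (rule integral_cong) (simp add: in1 A1)
    also have "\<dots> = integral (cball 0 2) (\<lambda>x. bump e w (\<Phi> x) * det (A x))"
    proof (rule integral_eq_of_zero_outside)
      fix x :: "(real,'m) vec" assume "x \<notin> cball 0 1"
      then have "min c 1 \<le> norm (\<Phi> x)" by (intro c') simp
      then show "bump e w (\<Phi> x) * det (A x) = 0"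
        using supp[of "\<Phi> x"] by fastforce
    qed auto
    also have "\<dots> = integral (cball 0 2) (bump e w)"
      by (rule integral_bump_compose_eq[OF J _ _ e]) (auto simp: out2)
    finally show "integral (cball 0 1) (\<lambda>x. bump e w (v x) * det (V x)) = integral (cball 0 2) (bump e w)" .
  qed
qed

lemma integral_change_of_variables_scalar:
  fixes f :: "real^'m::{finite,wellorder} \<Rightarrow> real" and g :: "real^'m::_ \<Rightarrow> real^'m::_"
  assumes "S \<in> sets lebesgue"
    and "\<And>x. x \<in> S \<Longrightarrow> (g has_derivative g' x) (at x within S)"
    and "inj_on g S" and f: "f absolutely_integrable_on (g ` S)"
  shows "((\<lambda>x. \<bar>det (matrix (g' x))\<bar> * f (g x)) has_integral integral (g ` S) f) S"
proof -
  let ?f = "\<lambda>x. vec (f x) :: real^1"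
  have "?f absolutely_integrable_on (g ` S) \<and> integral (g ` S) ?f = vec (integral (g ` S) f)"
    using f by (simp add: absolutely_integrable_on_1_iff integral_on_1_eq)
  then have "(\<lambda>x. \<bar>det (matrix (g' x))\<bar> *\<^sub>R ?f (g x)) absolutely_integrable_on S \<and>
      integral S (\<lambda>x. \<bar>det (matrix (g' x))\<bar> *\<^sub>R ?f (g x)) = vec (integral (g ` S) f)"
    using has_absolute_integral_change_of_variables[OF assms(1-3), of ?f] by blast
  then have "(\<lambda>x. \<bar>det (matrix (g' x))\<bar> * f (g x)) absolutely_integrable_on S"
      "integral S (\<lambda>x. \<bar>det (matrix (g' x))\<bar> * f (g x)) = integral (g ` S) f"
    by (simp_all add: absolutely_integrable_on_1_iff integral_on_1_eq)
  then show ?thesis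
    by (simp add: has_integral_iff set_lebesgue_integral_eq_integral(1))
qed

lemma jacobian_local_homeomorphism:
  fixes v :: "real^'m \<Rightarrow> real^'m"
  assumes v: "has_jacobian v V" and nz: "det (V z) \<noteq> 0"
  obtains U W g where "open U" "z \<in> U" "open W" "homeomorphism U W v g"
proof -
  obtain B where B: "B ** V z = mat 1"
    using nz by (metis invertible_det_nz invertible_left_inverse)
  define D where "D = (\<lambda>x. Blinfun (\<lambda>h. V x *v h))"
  have D: "blinfun_apply (D x) = (\<lambda>h. V x *v h)" for x
    unfolding D_def by (rule bounded_linear_Blinfun_apply) simp
  have BB: "blinfun_apply (Blinfun (\<lambda>h. B *v h)) = (\<lambda>h. B *v h)"
    by (rule bounded_linear_Blinfun_apply) simp
  show thesis
  proof (rule inverse_function_theorem[of UNIV v D z "Blinfun (\<lambda>h. B *v h)"])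
    show "(v has_derivative blinfun_apply (D x)) (at x)" for x
      unfolding D by (rule has_jacobianD(1)[OF v])
    show "continuous_on UNIV D"
      by (rule continuous_on_blinfun_componentwise)
        (auto simp: D matrix_vector_mult_def intro!: continuous_intros has_jacobianD(2)[OF v])
    show "Blinfun ((*v) B) o\<^sub>L D z = id_blinfun"
      by (rule blinfun_eqI) (simp add: BB D matrix_vector_mul_assoc B)
  qed (use that in auto)
qed

section \<open>Tangential fields with a symmetry\<close>

lemma bump_box_subset:
  fixes w :: "real^'m"
  assumes "open W" "w \<in> W"
  obtains e where "e > 0" "\<And>y. bump e w y \<noteq> 0 \<Longrightarrow> y \<in> W"
proof -
  obtain r where r: "r > 0" "ball w r \<subseteq> W"
    using assms openE by blast
  define e where "e = r / real CARD('m)"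
  have e: "e > 0" using r by (simp add: e_def)
  show thesis
  proof (rule that[OF e])
    fix y assume "bump e w y \<noteq> 0"
    then have *: "\<bar>(y - w) $ i\<bar> < e" for i
      using bump_pos_iff[OF e] by auto
    have "norm (y - w) \<le> (\<Sum>i\<in>UNIV. \<bar>(y - w) $ i\<bar>)" by (rule norm_le_l1_cart)
    also have "\<dots> < (\<Sum>i\<in>(UNIV :: 'm set). e)"
      by (rule sum_strict_mono) (use * in auto)
    also have "\<dots> = r" by (simp add: e_def)
    finally show "y \<in> W" using r by (auto simp: dist_norm norm_minus_commute)
  qed
qed

lemma integral_bump_pos:
  fixes w :: "real^'m"
  assumes e: "e > 0" and "w \<in> ball 0 2"
  shows "integral (cball 0 2) (bump e w) > 0"
proof -
  obtain a b where ab: "w \<in> box a b" "cbox a b \<subseteq> ball 0 2"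
    using assms open_contains_cbox[OF open_ball] by metis
  have c: "continuous_on S (bump e w)" for S
    using continuous_on_bump[OF continuous_on_id e, of S w] by simp
  have int: "bump e w integrable_on S" if "compact S" for S
    using that by (intro integrable_continuous_compact c)
  have "bump e w w \<noteq> 0" "w \<in> cbox a b"
    using e ab box_subset_cbox by (auto simp: bump_pos_iff)
  then have "integral (cbox a b) (bump e w) \<noteq> 0"
    using integral_cbox_eq_0_iff[OF c, of a b] ab bump_nonneg[OF e] by blast
  moreover have "integral (cbox a b) (bump e w) \<ge> 0"
    by (rule integral_nonneg[OF int]) (simp_all add: bump_nonneg e)
  moreover have "integral (cbox a b) (bump e w) \<le> integral (cball 0 2) (bump e w)"
    using ab(2) ball_subset_cball
    by (intro integral_subset_le int) (auto simp: bump_nonneg e)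
  ultimately show ?thesis by simp
qed

text \<open>
  The degree of \<open>v\<close> is one because \<open>v\<close> is tangential.  But \<open>v\<close> takes the same value at \<open>x\<close> and at
  \<open>R x \<noteq> x\<close>, and because the Jacobian determinant has constant sign these contributions cannot
  cancel.  Concretely: \<open>v\<close> maps a small neighbourhood \<open>U1\<close> of a point with invertible Jacobian, and
  likewise its disjoint preimage \<open>U2\<close> under \<open>R\<close>, injectively onto the same open set.  For a bump
  supported in this set, with integral \<open>I > 0\<close>, each of \<open>U1\<close> and \<open>U2\<close> contributes \<open>I\<close> to an integral
  whose total is \<open>I\<close>.
\<close>

lemma no_invariant_tangential_field:
  fixes v :: "real^'m::{finite,wellorder} \<Rightarrow> real^'m::_"
  assumes v: "has_jacobian v V" and tangential: "\<And>z. v z \<bullet> z = 0"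
    and nz: "\<And>z. z \<noteq> 0 \<Longrightarrow> v z \<noteq> 0"
    and sign: "(\<forall>z. 0 \<le> det (V z)) \<or> (\<forall>z. det (V z) \<le> 0)"
    and R: "linear R" "\<And>z. norm (R z) = norm z" "\<And>z. z \<noteq> 0 \<Longrightarrow> R z \<noteq> z"
    and inv: "\<And>z. v (R z) = v z"
  shows False
proof -
  have Rinj: "R x = R y \<longleftrightarrow> x = y" for x y
    using R(2)[of "x - y"] linear_diff[OF R(1), of x y] by auto
  have Rdist: "dist (R x) (R y) = dist x y" for x y
    using R(2)[of "x - y"] linear_diff[OF R(1), of x y] by (simp add: dist_norm)
  have Rsurj: "surj R"
    by (rule linear_injective_imp_surjective[OF R(1)]) (auto intro: injI simp: Rinj)
  have Rcont: "continuous_on UNIV R"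
    by (rule linear_continuous_on) (use R(1) linear_conv_bounded_linear in auto)
  have "norm z \<ge> 1 \<Longrightarrow> v z \<noteq> 0" for z
    by (rule nz) auto
  from tangential_field_bump_integral[OF v tangential this]
  obtain c where c: "c > 0" "c \<le> 1" and c1: "\<And>z. norm z = 1 \<Longrightarrow> c \<le> norm (v z)"
    and eq: "\<And>e w. e > 0 \<Longrightarrow> (\<And>y. bump e w y \<noteq> 0 \<Longrightarrow> norm y < c) \<Longrightarrow>
       integral (cball 0 1) (\<lambda>x. bump e w (v x) * det (V x)) = integral (cball 0 2) (bump e w)"
    by blast
  (* A point with invertible Jacobian exists, since the determinant integrates to something positive.
  Its value is kept within c of the origin, so that bumps around this value remain admissible. *)
  obtain z where z: "norm z < 1" "det (V z) \<noteq> 0" "norm (v z) < c"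
  proof -
    have "0 \<in> ball (0 :: (real,'m) vec) c" using c by simp
    from bump_box_subset[OF open_ball this]
    obtain e where e: "e > 0" "\<And>y :: (real,'m) vec. bump e 0 y \<noteq> 0 \<Longrightarrow> y \<in> ball 0 c"
      by metis
    then have "integral (cball 0 1) (\<lambda>x. bump e 0 (v x) * det (V x)) > 0"
      using integral_bump_pos[OF e(1), of "0 :: (real,'m) vec"] eq[of e 0] by auto
    moreover have "integral (cball 0 1) (\<lambda>x. bump e 0 (v x) * det (V x)) = 0"
      if "\<And>z. z \<in> cball 0 1 \<Longrightarrow> bump e 0 (v z) * det (V z) = 0"
      using that by (subst integral_cong[where g = "\<lambda>_. 0"]) auto
    ultimately have "\<exists>z\<in>cball 0 1. bump e 0 (v z) * det (V z) \<noteq> 0"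
      by (rule_tac ccontr) simp
    then obtain z where z: "z \<in> cball 0 1" "bump e 0 (v z) * det (V z) \<noteq> 0"
      by blast
    then have "norm (v z) < c" using e(2)[of "v z"] by auto
    moreover from this have "norm z < 1" using z(1) c1[of z] by (cases "norm z = 1") auto
    ultimately show thesis using z that by auto
  qed
  obtain U W g where U: "open U" "z \<in> U" and W: "open W" "homeomorphism U W v g"
    using jacobian_local_homeomorphism[OF v z(2)] .
  have injU: "inj_on v U"
    by (rule inj_on_inverseI[where g = g]) (rule homeomorphism_apply1[OF W(2)])
  (* Near the fixed point 0 of R the invariance contradicts local injectivity. *)
  have "z \<noteq> 0"
  proof
    assume "z = 0"
    then obtain d where d: "d > 0" "ball 0 d \<subseteq> U" using U openE[of U z] by blast
    obtain x :: "(real,'m) vec" where x: "norm x = d/2"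
      using d vector_choose_size[of "d/2"] by (metis half_gt_zero less_imp_le)
    then have "x \<in> ball 0 d" "R x \<in> ball 0 d" using d(1) by (simp_all add: R(2))
    then have "x \<in> U" "R x \<in> U" using d(2) by blast+
    then have "R x = x" using injU inv[of x] by (rule_tac inj_onD)
    moreover have "x \<noteq> 0" using x d(1) by auto
    ultimately show False using R(3) by blast
  qed
  (* Half the distance to R z, so that the \<delta>-ball around z and its preimage under R are disjoint. *)
  define \<delta> where "\<delta> = dist (R z) z / 2"
  have \<delta>: "\<delta> > 0" using R(3)[OF \<open>z \<noteq> 0\<close>] by (simp add: \<delta>_def)
  define U1 where "U1 = U \<inter> (ball z \<delta> \<inter> ball 0 1 \<inter> v -` ball 0 c)"
  have "open (v -` ball 0 c)"
    using has_jacobianD(3)[OF v, of UNIV] by (simp add: continuous_on_open_vimage)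
  then have oU1: "open U1" unfolding U1_def using U by (intro open_Int) auto
  have zU1: "z \<in> U1" using U z \<delta> by (simp add: U1_def)
  have "openin (top_of_set W) (v ` U1)"
    by (rule homeomorphism_imp_open_map[OF W(2)])
      (rule open_subset[OF _ oU1], simp add: U1_def)
  then have oW1: "open (v ` U1)" using W(1) openin_open_trans by blast
  have injU1: "inj_on v U1" using injU by (rule inj_on_subset) (simp add: U1_def)
  define U2 where "U2 = R -` U1"
  have oU2: "open U2" unfolding U2_def
    using Rcont oU1 by (simp add: continuous_on_open_vimage)
  have vU2: "v ` U2 = v ` U1"
  proof
    show "v ` U2 \<subseteq> v ` U1"
    proof clarify
      fix x assume "x \<in> U2"
      then have "v (R x) \<in> v ` U1" by (simp add: U2_def)
      then show "v x \<in> v ` U1" by (simp add: inv)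
    qed
    show "v ` U1 \<subseteq> v ` U2"
    proof clarify
      fix x assume "x \<in> U1"
      moreover obtain y where "x = R y" using Rsurj by blast
      ultimately show "v x \<in> v ` U2" by (auto simp: U2_def inv)
    qed
  qed
  have injU2: "inj_on v U2"
  proof (rule inj_onI)
    fix x y assume "x \<in> U2" "y \<in> U2" "v x = v y"
    then have "R x = R y" using injU1 by (auto simp: U2_def inj_on_def inv)
    then show "x = y" by (simp add: Rinj)
  qed
  have disj: "U1 \<inter> U2 = {}"
  proof (rule ccontr)
    assume "U1 \<inter> U2 \<noteq> {}"
    then obtain x where "x \<in> U1" "R x \<in> U1" by (auto simp: U2_def)
    then have "dist z x < \<delta>" "dist z (R x) < \<delta>" by (auto simp: U1_def)
    moreover have "dist (R z) z \<le> dist (R z) (R x) + dist (R x) z" by (rule dist_triangle)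
    ultimately show False by (simp add: Rdist \<delta>_def dist_commute)
  qed
  obtain e where e: "e > 0" and supp: "\<And>y. bump e (v z) y \<noteq> 0 \<Longrightarrow> y \<in> v ` U1"
    using bump_box_subset[OF oW1 imageI[OF zU1]] by blast
  define \<rho> where "\<rho> = bump e (v z)"
  define I where "I = integral (cball 0 2) \<rho>"
  have suppc: "norm y < c" if "bump e (v z) y \<noteq> 0" for y
    using supp[OF that] by (auto simp: U1_def)
  have c\<rho>: "continuous_on S (\<lambda>x. \<rho> (f x))" if "continuous_on S f" for S and f :: "(real,'m) vec \<Rightarrow> (real,'m) vec"
    unfolding \<rho>_def by (intro continuous_on_bump that e)
  have sub2: "v ` U1 \<subseteq> cball 0 2" using c by (auto simp: U1_def)
  have "\<rho> absolutely_integrable_on cball 0 2"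
  proof (rule nonnegative_absolutely_integrable_1)
    show "\<rho> integrable_on cball 0 2"
      using c\<rho>[OF continuous_on_id] by (intro integrable_continuous_compact) auto
  qed (simp add: \<rho>_def bump_nonneg e)
  then have aint: "\<rho> absolutely_integrable_on v ` U1"
    by (rule set_integrable_subset) (use oW1 sub2 in auto)
  have intI: "integral (v ` U1) \<rho> = I"
    unfolding I_def by (rule integral_eq_of_zero_outside[OF sub2]) (use supp \<rho>_def in auto)
  have cov: "((\<lambda>x. \<bar>det (V x)\<bar> * \<rho> (v x)) has_integral I) S"
    if "open S" "inj_on v S" "v ` S = v ` U1" for S
    using integral_change_of_variables_scalar[of S v "\<lambda>x h. V x *v h" \<rho>]
      has_jacobianD(1)[OF v] that aint intI by simp
  have two: "((\<lambda>x. \<bar>det (V x)\<bar> * \<rho> (v x)) has_integral (I + I)) (U1 \<union> U2)"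
    by (rule has_integral_Un[OF cov cov]) (use oU1 oU2 injU1 injU2 vU2 disj in auto)
  have sub1: "U1 \<union> U2 \<subseteq> cball 0 1"
    by (auto simp: U1_def U2_def R(2))
  have total: "(\<lambda>x. \<bar>det (V x)\<bar> * \<rho> (v x)) integrable_on cball 0 1"
    by (intro integrable_continuous_compact continuous_intros continuous_on_det_matrix
        has_jacobianD[OF v] c\<rho>) auto
  have "I + I \<le> integral (cball 0 1) (\<lambda>x. \<bar>det (V x)\<bar> * \<rho> (v x))"
    by (rule has_integral_subset_le[OF sub1 two integrable_integral[OF total]])
      (simp add: \<rho>_def bump_nonneg e)
  also have "\<dots> = \<bar>integral (cball 0 1) (\<lambda>x. \<rho> (v x) * det (V x))\<bar>"
    using sign
  proof
    assume pos: "\<forall>z. 0 \<le> det (V z)"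
    then have "0 \<le> integral (cball 0 1) (\<lambda>x. \<bar>det (V x)\<bar> * \<rho> (v x))"
      by (intro integral_nonneg[OF total]) (simp add: \<rho>_def bump_nonneg e)
    with pos show ?thesis by (simp add: mult.commute)
  next
    assume neg: "\<forall>z. det (V z) \<le> 0"
    have "0 \<le> integral (cball 0 1) (\<lambda>x. \<bar>det (V x)\<bar> * \<rho> (v x))"
      by (intro integral_nonneg[OF total]) (simp add: \<rho>_def bump_nonneg e)
    moreover have "(\<lambda>x. \<bar>det (V x)\<bar> * \<rho> (v x)) = (\<lambda>x. - (\<rho> (v x) * det (V x)))"
      using neg by (auto simp: fun_eq_iff)
    ultimately show ?thesis by simp
  qed
  also have "\<dots> = \<bar>I\<bar>"
    unfolding \<rho>_def I_def by (subst eq[OF e suppc]) auto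
  finally have "I + I \<le> \<bar>I\<bar>" .
  moreover have "I > 0"
    unfolding I_def \<rho>_def by (rule integral_bump_pos[OF e]) (use z c in auto)
  ultimately show False by simp
qed

section \<open>Real determinants of complex linear maps\<close>

text \<open>
  The matrices \<open>1 + \<mu> (M - 1)\<close> are singular for only finitely many complex \<open>\<mu>\<close>, and removing finitely
  many points does not disconnect the plane.  So if \<open>M\<close> is invertible, the real determinant, which
  vanishes only at the singular matrices, has the same sign at \<open>\<mu> = 1\<close> as at \<open>\<mu> = 0\<close>, where it is \<open>1\<close>.
  The maps \<open>T\<close> and \<open>T'\<close> are real coordinates on \<open>\<complex>\<^sup>n\<close>.
\<close>

lemma det_complex_linear_nonneg:
  fixes M :: "complex^'n^'n" and T :: "complex^'n \<Rightarrow> real^'m"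
  assumes T: "linear T" and T': "linear T'" and inv: "\<And>x. T' (T x) = x" "\<And>y. T (T' y) = y"
  shows "0 \<le> det (matrix (\<lambda>h. T (M *v T' h)))"
proof (rule ccontr)
  assume neg: "\<not> 0 \<le> det (matrix (\<lambda>h. T (M *v T' h)))"
  define N where "N = (\<lambda>\<mu> :: complex. (\<chi> i j. \<mu> * (M - mat 1) $ i $ j + mat 1 $ i $ j) :: complex^'n^'n)"
  define r where "r = (\<lambda>\<mu>. det (matrix (\<lambda>h. T (N \<mu> *v T' h))))"
  have lin: "linear (\<lambda>h. T (A *v T' h))" for A :: "complex^'n^'n"
  proof -
    have "linear ((*v) A)" by (simp add: linear_conv_bounded_linear)
    then have "linear (T \<circ> ((*v) A \<circ> T'))" by (intro linear_compose T T')
    then show ?thesis by (simp add: o_def)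
  qed
  have T0: "T x = 0 \<longleftrightarrow> x = 0" for x
    using inv(1)[of x] linear_0[OF T] linear_0[OF T'] by auto
  have T'0: "T' x = 0 \<longleftrightarrow> x = 0" for x
    using inv(2)[of x] linear_0[OF T] linear_0[OF T'] by auto
  have iff: "r \<mu> = 0 \<longleftrightarrow> det (N \<mu>) = 0" for \<mu>
  proof -
    have "r \<mu> \<noteq> 0 \<longleftrightarrow> (\<forall>h. T (N \<mu> *v T' h) = 0 \<longrightarrow> h = 0)"
      unfolding r_def det_nonzero_iff_kernel_trivial using matrix_works[of "\<lambda>h. T (N \<mu> *v T' h)"] lin
      by (simp add: linear_matrix_vector_mul_eq)
    also have "\<dots> \<longleftrightarrow> (\<forall>x. N \<mu> *v x = 0 \<longrightarrow> x = 0)"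
      unfolding T0
    proof (intro iffI allI impI)
      fix x assume "\<forall>h. N \<mu> *v T' h = 0 \<longrightarrow> h = 0" "N \<mu> *v x = 0"
      then have "T x = 0" by (simp add: inv)
      then show "x = 0" by (simp add: T0)
    qed (use T'0 in blast)
    finally show ?thesis using det_nonzero_iff_kernel_trivial[of "N \<mu>"] by blast
  qed
  have "polynomial_family (UNIV :: real set) (\<lambda>\<mu> x. det (N \<mu>))"
    unfolding N_def by (intro polynomial_family_det continuous_intros)
  then obtain n and c :: "nat \<Rightarrow> real \<Rightarrow> complex"
    where c: "\<And>\<mu> x. det (N \<mu>) = (\<Sum>i\<le>n. c i x * \<mu> ^ i)"
    unfolding polynomial_family_def by blast
  have N0: "N 0 = mat 1" and N1: "N 1 = M" by (simp_all add: N_def vec_lambda_eta)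
  have "\<exists>i\<le>n. c i 0 \<noteq> 0"
  proof (rule ccontr)
    assume "\<not> (\<exists>i\<le>n. c i 0 \<noteq> 0)"
    then have "(\<Sum>i\<le>n. c i 0 * 0 ^ i) = 0" by (intro sum.neutral) auto
    then have "det (N 0) = 0" by (subst c)
    then show False unfolding N0 by simp
  qed
  then have "finite {\<mu>. det (N \<mu>) = 0}"
    using polyfun_finite_roots[of "\<lambda>i. c i 0" n] unfolding c[where x = 0] by (rule iffD2[rotated])
  then have conn: "connected (UNIV - {\<mu>. det (N \<mu>) = 0})"
    by (intro connected_open_delete_finite connected_UNIV) simp_all
  have cont: "continuous_on UNIV r"
  proof -
    have NT: "continuous_on UNIV (\<lambda>\<mu>. N \<mu> *v h)" for h
      unfolding N_def matrix_vector_mult_def by (auto intro!: continuous_intros)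
    have TN: "continuous_on UNIV (\<lambda>\<mu>. T (N \<mu> *v h))" for h
      by (rule linear_continuous_on_compose[OF NT T])
    show ?thesis
      unfolding r_def matrix_def
      by (intro continuous_on_det_matrix continuous_intros TN)
  qed
  have "(\<lambda>h. T (N 0 *v T' h)) = (\<lambda>h. h)" by (simp add: N0 inv)
  then have r0: "r 0 = 1" by (simp add: r_def matrix_id_mat_1[unfolded id_def])
  have r1: "r 1 < 0" using neg by (simp only: r_def N1 not_le)
  have mem: "r \<mu> \<in> r ` (UNIV - {\<mu>. det (N \<mu>) = 0})" if "r \<mu> \<noteq> 0" for \<mu>
    using that iff[of \<mu>] by (intro imageI) simp
  have "{r 1..r 0} \<subseteq> r ` (UNIV - {\<mu>. det (N \<mu>) = 0})"
  proof (rule connected_contains_Icc)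
    show "connected (r ` (UNIV - {\<mu>. det (N \<mu>) = 0}))"
      by (rule connected_continuous_image[OF continuous_on_subset[OF cont subset_UNIV] conn])
    show "r 1 \<in> r ` (UNIV - {\<mu>. det (N \<mu>) = 0})" using r1 by (intro mem) simp
    show "r 0 \<in> r ` (UNIV - {\<mu>. det (N \<mu>) = 0})" using r0 by (intro mem) simp
  qed
  moreover have "0 \<in> {r 1..r 0}" using r0 r1 by simp
  ultimately have "0 \<in> r ` (UNIV - {\<mu>. det (N \<mu>) = 0})" by (rule subsetD)
  then obtain \<mu> where "r \<mu> = 0" "det (N \<mu>) \<noteq> 0" by (elim imageE) simp
  then show False using iff by simp
qed

section \<open>Complex polynomials in several variables\<close>

text \<open>
  Continuous complex differentiability, with the vector of partial derivatives as data: it is the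
  complex linearity of the derivative that makes the real Jacobian determinant nonnegative.
\<close>

definition has_gradient :: "(complex^'n \<Rightarrow> complex) \<Rightarrow> (complex^'n \<Rightarrow> complex^'n) \<Rightarrow> bool" where
  "has_gradient f d \<longleftrightarrow>
     (\<forall>z. (f has_derivative (\<lambda>h. \<Sum>j\<in>UNIV. d z $ j * h $ j)) (at z)) \<and> continuous_on UNIV d"

lemma has_gradient_continuous: "has_gradient f d \<Longrightarrow> continuous_on UNIV f"
  unfolding has_gradient_def by (auto intro: has_derivative_continuous_on)

lemma has_gradient_const: "has_gradient (\<lambda>z. c) (\<lambda>z. 0)"
  by (simp add: has_gradient_def)

lemma has_gradient_coordinate: "has_gradient (\<lambda>z. z $ i) (\<lambda>z. axis i 1)"
  by (auto simp: has_gradient_def axis_def if_distrib[of "\<lambda>x. x * _"] cong: if_cong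
      intro!: bounded_linear_imp_has_derivative bounded_linear_vec_nth)

lemma has_gradient_add:
  assumes "has_gradient f d" "has_gradient g e"
  shows "has_gradient (\<lambda>z. f z + g z) (\<lambda>z. d z + e z)"
  using assms unfolding has_gradient_def
  by (auto intro!: derivative_eq_intros continuous_intros simp: distrib_right sum.distrib)

lemma has_gradient_mult:
  assumes f: "has_gradient f d" and g: "has_gradient g e"
  shows "has_gradient (\<lambda>z. f z * g z) (\<lambda>z. f z *s e z + g z *s d z)"
  unfolding has_gradient_def
proof (intro conjI allI)
  fix z
  show "((\<lambda>z. f z * g z) has_derivative (\<lambda>h. \<Sum>j\<in>UNIV. (f z *s e z + g z *s d z) $ j * h $ j)) (at z)"
    by (rule has_derivative_eq_rhs[OF has_derivative_mult])
      (use f g in \<open>auto simp: has_gradient_def sum_distrib_left sum_distrib_right sum.distrib algebra_simps fun_eq_iff\<close>)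
  show "continuous_on UNIV (\<lambda>z. f z *s e z + g z *s d z)"
    unfolding vector_scalar_mult_def
    using f g has_gradient_continuous[OF f] has_gradient_continuous[OF g]
    by (auto simp: has_gradient_def intro!: continuous_intros)
qed

lemma has_gradient_power:
  "\<exists>d. has_gradient (\<lambda>z. (z $ i) ^ n) d"
proof (induction n)
  case 0
  show ?case using has_gradient_const[of 1] by auto
next
  case (Suc n)
  then show ?case using has_gradient_mult[OF has_gradient_coordinate[of i]] by auto
qed

lemma has_gradient_prod:
  assumes "\<And>i. i \<in> I \<Longrightarrow> \<exists>d. has_gradient (f i) d"
  shows "\<exists>d. has_gradient (\<lambda>z. \<Prod>i\<in>I. f i z) d"
  using assms
proof (induction I rule: infinite_finite_induct)
  case (insert i I)
  obtain d where d: "has_gradient (f i) d" using insert.prems by blast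
  obtain e where e: "has_gradient (\<lambda>z. \<Prod>i\<in>I. f i z) e" using insert.IH insert.prems by blast
  show ?case using has_gradient_mult[OF d e] insert.hyps by auto
qed (use has_gradient_const[of 1] in auto)

lemma has_gradient_sum:
  assumes "\<And>i. i \<in> I \<Longrightarrow> \<exists>d. has_gradient (f i) d"
  shows "\<exists>d. has_gradient (\<lambda>z. \<Sum>i\<in>I. f i z) d"
  using assms
proof (induction I rule: infinite_finite_induct)
  case (insert i I)
  obtain d where d: "has_gradient (f i) d" using insert.prems by blast
  obtain e where e: "has_gradient (\<lambda>z. \<Sum>i\<in>I. f i z) e" using insert.IH insert.prems by blast
  show ?case using has_gradient_add[OF d e] insert.hyps by auto
qed (use has_gradient_const[of 0] in auto)

lemma mvpoly_eval_has_gradient: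
  fixes p :: "('n::finite, complex) mvpoly"
  shows "\<exists>d. has_gradient (mvpoly_eval p) d"
proof -
  have "\<exists>d. has_gradient (\<lambda>z. \<Sum>m\<in>Poly_Mapping.keys p.
        Poly_Mapping.lookup p m * (\<Prod>i\<in>UNIV. (z $ i) ^ Poly_Mapping.lookup m i)) d"
  proof (rule has_gradient_sum)
    fix m :: "'n \<Rightarrow>\<^sub>0 nat"
    obtain d where "has_gradient (\<lambda>z. \<Prod>i\<in>UNIV. (z $ i) ^ Poly_Mapping.lookup m i :: complex) d"
      using has_gradient_prod[of UNIV "\<lambda>i z. (z $ i) ^ Poly_Mapping.lookup m i"] has_gradient_power by blast
    then show "\<exists>d. has_gradient (\<lambda>z. Poly_Mapping.lookup p m * (\<Prod>i\<in>UNIV. (z $ i) ^ Poly_Mapping.lookup m i)) d"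
      using has_gradient_mult[OF has_gradient_const] by blast
  qed
  then show ?thesis by (simp add: mvpoly_eval_def[abs_def])
qed

lemma mvpoly_eval_scale:
  assumes "homogeneous_of_degree k p"
  shows "mvpoly_eval p (a *s z) = a ^ k * mvpoly_eval p z"
proof -
  have "(\<Prod>i\<in>UNIV. ((a *s z) $ i) ^ Poly_Mapping.lookup m i)
      = a ^ k * (\<Prod>i\<in>UNIV. (z $ i) ^ Poly_Mapping.lookup m i)" if "m \<in> Poly_Mapping.keys p" for m
  proof -
    have "(\<Prod>i\<in>UNIV. a ^ Poly_Mapping.lookup m i) = a ^ k"
      using assms that by (simp add: homogeneous_of_degree_def power_sum[symmetric])
    then show ?thesis by (simp add: power_mult_distrib prod.distrib)
  qed
  then show ?thesis
    by (simp add: mvpoly_eval_def sum_distrib_left mult_ac)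
qed

lemma norm_scalar_mult_vec: "norm (a *s z) = norm a * norm (z :: complex^'n)"
  unfolding norm_vec_def vector_scalar_mult_def vec_lambda_beta norm_mult
  by (rule L2_set_right_distrib[symmetric]) simp

section \<open>Common roots\<close>

theorem proposition3p1p1:
  fixes P :: "'n::finite \<Rightarrow> ('n, complex) mvpoly"
    and k :: nat
  assumes "k \<ge> 2"
    and "\<And>j. homogeneous_of_degree k (P j)"
    and "\<forall>z :: complex ^ 'n. (\<Sum>i\<in>UNIV. z $ i * mvpoly_eval (P i) z) = 0"
  shows "\<exists>z :: complex ^ 'n. z \<noteq> 0 \<and> (\<forall>j. mvpoly_eval (P j) z = 0)"
proof (rule ccontr)
  assume "\<not> ?thesis"
  then have no_root: "z = 0" if "\<forall>j. mvpoly_eval (P j) z = 0" for z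
    using that by auto
  (* Identify \<complex>^n isometrically with \<real>^(2n).  The type 'n bit0 has 2n elements and, unlike 'n + 'n, is
  well-ordered, which the change of variables theorem asks of its index type. *)
  have "DIM(complex^'n) = DIM(real^'n bit0)" by simp
  then have "\<exists>(T :: complex^'n \<Rightarrow> real^'n bit0) T'. linear T \<and> linear T' \<and>
      (\<forall>x. norm (T x) = norm x) \<and> (\<forall>y. norm (T' y) = norm y) \<and>
      (\<forall>x. T' (T x) = x) \<and> (\<forall>y. T (T' y) = y)"
    by (rule isomorphisms_UNIV_UNIV) auto
  then obtain T :: "complex^'n \<Rightarrow> real^'n bit0" and T' where T: "linear T" and T': "linear T'"
    and nT: "\<And>x. norm (T x) = norm x" and nT': "\<And>y. norm (T' y) = norm y"
    and inv: "\<And>x. T' (T x) = x" "\<And>y. T (T' y) = y"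
    by blast
  have T0: "T x = 0 \<longleftrightarrow> x = 0" for x
  proof -
    have "T x = 0 \<longleftrightarrow> norm (T x) = 0" by simp
    then show ?thesis unfolding nT by simp
  qed
  have T'0: "T' y = 0 \<longleftrightarrow> y = 0" for y
  proof -
    have "T' y = 0 \<longleftrightarrow> norm (T' y) = 0" by simp
    then show ?thesis unfolding nT' by simp
  qed
  have iT: "T x \<bullet> T y = x \<bullet> y" for x y
    unfolding dot_norm linear_add[OF T, symmetric] nT ..
  have "\<forall>i. \<exists>d. has_gradient (mvpoly_eval (P i)) d"
    using mvpoly_eval_has_gradient by blast
  from choice[OF this] obtain d where d: "\<And>i. has_gradient (mvpoly_eval (P i)) (d i)"
    by blast
  define conj :: "complex^'n \<Rightarrow> complex^'n" where "conj = (\<lambda>x. \<chi> i. cnj (x $ i))"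
  define Q where "Q = (\<lambda>z. (\<chi> i. mvpoly_eval (P i) z))"
  define D where "D = (\<lambda>z. (\<chi> i j. d i z $ j))"
  have conj_lin: "linear conj"
    by (rule linearI) (simp_all add: conj_def vec_eq_iff)
  have DV_lin: "linear ((*v) (D z))" for z
    by (simp add: linear_conv_bounded_linear)
  have dQ: "(Q has_derivative (\<lambda>h. D z *v h)) (at z)" for z
  proof (rule iffD2[OF has_derivative_componentwise_within], rule ballI)
    fix b :: "complex^'n" assume "b \<in> Basis"
    then obtain j u where b: "b = axis j u" by (auto simp: Basis_vec_def)
    have "(mvpoly_eval (P j) has_derivative (\<lambda>h. (D z *v h) $ j)) (at z)"
      using d[of j] by (simp add: has_gradient_def D_def matrix_vector_mult_def)
    from has_derivative_inner_left[OF this, of u]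
    show "((\<lambda>x. Q x \<bullet> b) has_derivative (\<lambda>h. (D z *v h) \<bullet> b)) (at z)"
      by (simp add: b inner_axis Q_def)
  qed
  (* Conjugation turns the bilinear hypothesis into orthogonality for the real inner product. *)
  define v where "v = (\<lambda>y. T (conj (Q (T' y))))"
  (* The derivative of v factors through the fixed real linear map C; the other factor is complex
  linear, so the sign of det (V y) is that of det C for every y. *)
  define C where "C = (\<lambda>h. T (conj (T' h)))"
  define L where "L = (\<lambda>y h. T (D (T' y) *v T' h))"
  define V where "V = (\<lambda>y. matrix C ** matrix (L y))"
  have C_lin: "linear C"
    using linear_compose[OF linear_compose[OF T' conj_lin] T] by (simp add: C_def o_def)
  have L_lin: "linear (L y)" for y
    using linear_compose[OF linear_compose[OF T' DV_lin] T] by (simp add: L_def o_def)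
  have VV: "V y *v h = T (conj (D (T' y) *v T' h))" for y h
  proof -
    have "V y *v h = C (L y h)"
      using C_lin L_lin by (simp add: V_def matrix_vector_mul_assoc[symmetric] matrix_works linear_matrix_vector_mul_eq)
    then show ?thesis by (simp add: C_def L_def inv)
  qed
  have J: "has_jacobian v V"
    unfolding has_jacobian_def
  proof (intro conjI allI)
    fix y
    have bl: "bounded_linear T'" "bounded_linear (\<lambda>x. T (conj x))"
      using T' linear_compose[OF conj_lin T] by (simp_all add: linear_conv_bounded_linear o_def)
    have "((\<lambda>y. Q (T' y)) has_derivative (\<lambda>h. D (T' y) *v T' h)) (at y)"
      by (rule has_derivative_compose[OF bounded_linear_imp_has_derivative[OF bl(1)] dQ])
    then show "(v has_derivative (\<lambda>h. V y *v h)) (at y)"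
      unfolding VV v_def by (rule bounded_linear.has_derivative[OF bl(2)])
    have dT: "continuous_on UNIV (\<lambda>y. d i (T' y))" for i
      by (rule continuous_on_compose2[of UNIV "d i" UNIV T'])
        (use d[of i] linear_continuous_on[OF bl(1)] in \<open>auto simp: has_gradient_def\<close>)
    have "continuous_on UNIV (\<lambda>y. D (T' y) *v h)" for h
      unfolding D_def matrix_vector_mult_def by (auto intro!: continuous_intros dT)
    then have "continuous_on UNIV (\<lambda>y. L y h)" for h
      unfolding L_def by (rule linear_continuous_on_compose[OF _ T])
    then show "continuous_on UNIV V"
      unfolding V_def matrix_matrix_mult_def matrix_def by (auto intro!: continuous_intros)
  qed
  have pos: "0 \<le> det (matrix (L y))" for y
    unfolding L_def by (rule det_complex_linear_nonneg[OF T T' inv])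
  define \<omega> where "\<omega> = exp (2 * of_real pi * \<i> * of_nat 1 / of_nat k)"
  have \<omega>: "\<omega> ^ k = 1" "\<omega> \<noteq> 1" "norm \<omega> = 1"
  proof -
    show *: "\<omega> ^ k = 1"
      unfolding \<omega>_def by (rule complex_root_unity) (use assms(1) in simp)
    show "\<omega> \<noteq> 1"
      unfolding \<omega>_def using assms(1) by (subst complex_root_unity_eq_1) auto
    show "norm \<omega> = 1"
      using power_eq_1_iff[OF *] assms(1) by auto
  qed
  define R where "R = (\<lambda>y. T (\<omega> *s T' y))"
  show False
  proof (rule no_invariant_tangential_field[OF J, of R])
    show "v y \<bullet> y = 0" for y
    proof -
      have "v y \<bullet> y = conj (Q (T' y)) \<bullet> T' y"
        using iT[of "conj (Q (T' y))" "T' y"] by (simp add: v_def inv)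
      also have "\<dots> = Re (\<Sum>i\<in>UNIV. T' y $ i * mvpoly_eval (P i) (T' y))"
        by (simp add: inner_vec_def conj_def Q_def inner_complex_def algebra_simps)
      finally show ?thesis using assms(3) by simp
    qed
    show "v y \<noteq> 0" if "y \<noteq> 0" for y
    proof
      assume "v y = 0"
      then have "conj (Q (T' y)) = 0" by (simp add: v_def T0)
      then have "conj (Q (T' y)) $ j = 0" for j by simp
      then have "mvpoly_eval (P j) (T' y) = 0" for j by (simp add: conj_def Q_def)
      then show False using no_root[of "T' y"] that by (simp add: T'0)
    qed
    show "(\<forall>y. 0 \<le> det (V y)) \<or> (\<forall>y. det (V y) \<le> 0)"
      unfolding V_def det_mul using pos by (cases "0 \<le> det (matrix C)") (auto simp: mult_nonpos_nonneg)
    show "linear R"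
    proof -
      have "linear (\<lambda>x :: complex^'n. \<omega> *s x)"
        by (rule linearI) (simp_all add: vec_eq_iff algebra_simps)
      from linear_compose[OF linear_compose[OF T' this] T] show ?thesis
        by (simp add: R_def o_def)
    qed
    show "norm (R y) = norm y" for y
      by (simp add: R_def nT nT' norm_scalar_mult_vec \<omega>)
    show "R y \<noteq> y" if "y \<noteq> 0" for y
    proof
      assume "R y = y"
      then have "\<omega> *s T' y = T' y" using inv(1) unfolding R_def by metis
      then have "\<omega> * T' y $ i = T' y $ i" for i by (metis vector_smult_component)
      then have "T' y $ i = 0" for i using \<omega>(2) by (metis mult_cancel_right1)
      then have "T' y = 0" by (simp add: vec_eq_iff)
      then show False using T'0 that by simp
    qed
    show "v (R y) = v y" for y
      by (simp add: v_def R_def inv Q_def mvpoly_eval_scale[OF assms(2)] \<omega>)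
  qed
qed

end
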